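(* For every fixed $\varepsilon>0$ there is an $m_0=m_0(\varepsilon)$ such that for every integer $m\ge m_0$ and every $\mathcal{A}\in\mathscr{A}_m$: if $R_m=6$, then $$(\sqrt3-\varepsilon)\sqrt m\le|\mathcal{A}|\le(2+\varepsilon)\sqrt m.$$
   Context: For a positive integer $m$ let $\mathbb{Z}_m=\mathbb{Z}/m\mathbb{Z}$. For $\mathcal{A}\subseteq \mathbb{Z}_m$ and $n\in\mathbb{Z}_m$ put $\sigma_{\mathcal{A}}(n)=\#\{(a,a')\in\mathcal{A}^2: a+a'\equiv n \pmod m\}$ (ordered pairs). The Ruzsa number $R_m$ is the least integer $r$ such that there is a subset $\mathcal{A}\subseteq\mathbb{Z}_m$ with $1\le \sigma_{\mathcal{A}}(n)\le r$ for all $n\in\mathbb{Z}_m$. $\mathscr{A}_m$ denotes the set of all subsets $\mathcal{A}\subseteq[0,m-1]$ of integers (identified with subsets of $\mathbb{Z}_m$) such that $1\le\sigma_{\mathcal{A}}(n)\le R_m$ for all $n\in\mathbb{Z}_m$. *)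

theory Defs
  imports Complex_Main "HOL-Number_Theory.Cong"
begin

(* Subsets of Z/mZ are represented by sets of integers contained in {0..<int m}. *)

definition rep_count :: "nat \<Rightarrow> int set \<Rightarrow> int \<Rightarrow> nat" where
  "rep_count m A n = card {(a, a'). a \<in> A \<and> a' \<in> A \<and> [a + a' = n] (mod int m)}"

definition rep_bounded :: "nat \<Rightarrow> nat \<Rightarrow> int set \<Rightarrow> bool" where
  "rep_bounded m r A \<longleftrightarrow>
     A \<subseteq> {0..<int m} \<and> (\<forall>n\<in>{0..<int m}. 1 \<le> rep_count m A n \<and> rep_count m A n \<le> r)"

definition ruzsa_number :: "nat \<Rightarrow> nat" where
  "ruzsa_number m = (LEAST r. \<exists>A. rep_bounded m r A)"

definition ruzsa_sets :: "nat \<Rightarrow> int set set" where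
  "ruzsa_sets m = {A. rep_bounded m (ruzsa_number m) A}"

(* The minimum in ruzsa_number is attained, so the LEAST is never a junk value. *)
lemma ruzsa_sets_nonempty:
  shows "ruzsa_sets m \<noteq> {}"
proof -
  let ?A = "{0..<int m}"
  let ?P = "\<lambda>n. {(a, a'). a \<in> ?A \<and> a' \<in> ?A \<and> [a + a' = n] (mod int m)}"
  have fin: "finite (?P n)" for n
    by (rule finite_subset[of _ "?A \<times> ?A"]) (blast, simp)
  have "rep_bounded m (card (?A \<times> ?A)) ?A"
    unfolding rep_bounded_def rep_count_def
  proof (intro conjI ballI)
    fix n assume n: "n \<in> ?A"
    then have "0 \<in> ?A" by simp
    with n have "(0, n) \<in> ?P n" by simp
    then have "?P n \<noteq> {}" by blast
    then have "card (?P n) \<noteq> 0" using fin[of n] by (simp only: card_0_eq not_False_eq_True)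
    then show "1 \<le> card (?P n)" by linarith
    show "card (?P n) \<le> card (?A \<times> ?A)"
      by (rule card_mono) (simp, blast)
  qed (rule subset_refl)
  then have "\<exists>r A. rep_bounded m r A" by blast
  then have "\<exists>A. rep_bounded m (ruzsa_number m) A"
    unfolding ruzsa_number_def by (rule LeastI_ex)
  then show ?thesis by (auto simp: ruzsa_sets_def)
qed

end

theory Submission
  imports Defs "HOL-Analysis.Convex"
begin

text \<open>
  Let \<open>k = |A|\<close>, and let \<open>\<sigma>(n)\<close>, \<open>d(n)\<close> count the representations of \<open>n\<close> as a sum and as a
  difference of two elements of \<open>A\<close>. Both have the same second moment, the additive energy of \<open>A\<close>.
  Since \<open>d(0) = k\<close>, Cauchy-Schwarz bounds the energy below by about \<open>k\<^sup>2 + k\<^sup>4/m\<close>.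
  On the other hand, swapping the summands shows that \<open>\<sigma>(n)\<close> is even for all but at most \<open>k\<close>
  residues, so that \<open>\<sigma>(n) \<in> {2, 4, 6}\<close> and \<open>(\<sigma>(n) - 2) (\<sigma>(n) - 6) \<le> 0\<close> there; summing, the energy
  is at most about \<open>8 k\<^sup>2 - 12 m\<close>. Together, \<open>(k\<^sup>2 - 3 m) (k\<^sup>2 - 4 m) \<le> O(m\<^bsup>3/2\<^esup>)\<close>.
\<close>

section \<open>Double counting over the fibres of a map\<close>

lemma sum_card_fibres:
  assumes "finite S" "finite I" "g ` S \<subseteq> I"
  shows "(\<Sum>n\<in>I. card {x\<in>S. g x = n}) = card S"
  using sum.group[OF assms, of "\<lambda>_. 1::nat"] by simp

text \<open>A pair with a common image lies in the square of exactly one fibre. Thus a second moment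
  of fibre sizes becomes a count of coincidences.\<close>

lemma sum_card_fibres_squared:
  assumes "finite S" "finite I" "g ` S \<subseteq> I"
  shows "(\<Sum>n\<in>I. (card {x\<in>S. g x = n})\<^sup>2) = card {(x, y)\<in>S \<times> S. g x = g y}"
proof -
  let ?T = "{(x, y)\<in>S \<times> S. g x = g y}"
  have fin: "finite ?T"
    by (rule finite_subset[of _ "S \<times> S"]) (use assms in auto)
  have "{p\<in>?T. g (fst p) = n} = {x\<in>S. g x = n} \<times> {x\<in>S. g x = n}" for n
    by auto
  then have "(card {x\<in>S. g x = n})\<^sup>2 = card {p\<in>?T. g (fst p) = n}" for n
    by (simp only: card_cartesian_product power2_eq_square)
  moreover have "(\<Sum>n\<in>I. card {p\<in>?T. g (fst p) = n}) = card ?T"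
    by (rule sum_card_fibres[OF fin assms(2)]) (use assms in auto)
  ultimately show ?thesis by simp
qed

section \<open>Additive energy from sums and from differences\<close>

definition diff_count :: "nat \<Rightarrow> int set \<Rightarrow> int \<Rightarrow> nat" where
  "diff_count m A n = card {p\<in>A \<times> A. (fst p - snd p) mod int m = n}"

lemma rep_count_eq_card_fibre:
  assumes "n \<in> {0..<int m}"
  shows "rep_count m A n = card {p\<in>A \<times> A. (fst p + snd p) mod int m = n}"
proof -
  have "{(a, a'). a \<in> A \<and> a' \<in> A \<and> [a + a' = n] (mod int m)} =
    {p\<in>A \<times> A. (fst p + snd p) mod int m = n}"
    using assms by (auto simp: cong_def)
  then show ?thesis by (simp add: rep_count_def)
qed

lemma sum_rep_count:
  assumes "finite A" "m > 0"
  shows "(\<Sum>n\<in>{0..<int m}. rep_count m A n) = (card A)\<^sup>2"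
proof -
  have "(\<Sum>n\<in>{0..<int m}. rep_count m A n) =
    (\<Sum>n\<in>{0..<int m}. card {p\<in>A \<times> A. (fst p + snd p) mod int m = n})"
    by (intro sum.cong refl rep_count_eq_card_fibre)
  also have "\<dots> = card (A \<times> A)"
    by (rule sum_card_fibres) (use assms in auto)
  finally show ?thesis by (simp add: card_cartesian_product power2_eq_square)
qed

lemma sum_diff_count:
  assumes "finite A" "m > 0"
  shows "(\<Sum>n\<in>{0..<int m}. diff_count m A n) = (card A)\<^sup>2"
proof -
  have "(\<Sum>n\<in>{0..<int m}. diff_count m A n) = card (A \<times> A)"
    unfolding diff_count_def by (rule sum_card_fibres) (use assms in auto)
  then show ?thesis by (simp add: card_cartesian_product power2_eq_square)
qed

text \<open>Both sides count quadruples: \<open>a + b = c + d\<close> modulo \<open>m\<close> is the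
  same as \<open>a - d = c - b\<close>, so exchanging the second components, an involution, carries
  one set of quadruples onto the other.\<close>

lemma sum_rep_count_squared_eq_sum_diff_count_squared:
  assumes "finite A" "m > 0"
  shows "(\<Sum>n\<in>{0..<int m}. (rep_count m A n)\<^sup>2) = (\<Sum>n\<in>{0..<int m}. (diff_count m A n)\<^sup>2)"
proof -
  let ?s = "\<lambda>p. (fst p + snd p) mod int m" and ?d = "\<lambda>p. (fst p - snd p) mod int m"
  let ?S = "{(x, y)\<in>(A \<times> A) \<times> (A \<times> A). ?s x = ?s y}"
  let ?D = "{(x, y)\<in>(A \<times> A) \<times> (A \<times> A). ?d x = ?d y}"
  have swap: "(a + b) mod int m = (c + d) mod int m \<longleftrightarrow> (a - d) mod int m = (c - b) mod int m"
    for a b c d :: int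
    by (simp add: mod_eq_dvd_iff algebra_simps)
  have "(\<Sum>n\<in>{0..<int m}. (rep_count m A n)\<^sup>2) =
    (\<Sum>n\<in>{0..<int m}. (card {p\<in>A \<times> A. ?s p = n})\<^sup>2)"
    by (intro sum.cong refl) (simp only: rep_count_eq_card_fibre)
  also have "\<dots> = card ?S"
    by (rule sum_card_fibres_squared) (use assms in auto)
  also have "\<dots> = card ?D"
    by (rule bij_betw_same_card[of "\<lambda>((a, b), (c, d)). ((a, d), (c, b))"],
        rule bij_betw_byWitness[where f' = "\<lambda>((a, b), (c, d)). ((a, d), (c, b))"])
       (auto simp: swap)
  also have "\<dots> = (\<Sum>n\<in>{0..<int m}. (diff_count m A n)\<^sup>2)"
    unfolding diff_count_def
    by (rule sum_card_fibres_squared[symmetric]) (use assms in auto)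
  finally show ?thesis .
qed

text \<open>Elements of \<open>A\<close> are reduced residues, so congruent ones coincide and only
  diagonal pairs contribute.\<close>

lemma diff_count_0:
  assumes "A \<subseteq> {0..<int m}"
  shows "diff_count m A 0 = card A"
proof -
  have "a = b" if "a \<in> A" "b \<in> A" "(a - b) mod int m = 0" for a b
  proof -
    have "a mod int m = b mod int m"
      using that(3) by (simp add: mod_eq_dvd_iff mod_eq_0_iff_dvd)
    then show ?thesis using that(1,2) assms by (auto simp: subset_iff)
  qed
  then have "{p\<in>A \<times> A. (fst p - snd p) mod int m = 0} = (\<lambda>a. (a, a)) ` A"
    by fastforce
  then show ?thesis
    by (simp add: diff_count_def card_image inj_on_def)
qed

text \<open>The zero difference is split off before Cauchy-Schwarz is applied to the other residues.
  Its contribution \<open>k\<^sup>2\<close> has the same order as the main term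
  \<open>k\<^sup>4 / m\<close> when \<open>k\<close> is of order \<open>sqrt m\<close>, so it
  affects the final constants.\<close>

lemma energy_lower_bound:
  assumes "A \<subseteq> {0..<int m}" "m > 0"
  defines "k \<equiv> real (card A)"
  shows "real m * k\<^sup>2 + (k\<^sup>2 - k)\<^sup>2 \<le> real m * (\<Sum>n\<in>{0..<int m}. (real (rep_count m A n))\<^sup>2)"
proof -
  let ?I = "{0..<int m}" and ?d = "\<lambda>n. real (diff_count m A n)"
  let ?J = "?I - {0}"
  have fin: "finite A" using assms(1) finite_subset by blast
  have 0: "0 \<in> ?I" using assms(2) by simp
  have "(\<Sum>n\<in>?I. ?d n) = k\<^sup>2"
    using sum_diff_count[OF fin assms(2)] by (simp add: k_def flip: of_nat_sum)
  then have J: "(\<Sum>n\<in>?J. ?d n) = k\<^sup>2 - k"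
    using 0 by (simp add: sum_diff1 diff_count_0[OF assms(1)] k_def)
  have "(\<Sum>n\<in>?I. (?d n)\<^sup>2) = k\<^sup>2 + (\<Sum>n\<in>?J. (?d n)\<^sup>2)"
    using 0 by (simp add: sum.remove[of ?I 0] diff_count_0[OF assms(1)] k_def)
  moreover have "(\<Sum>n\<in>?I. (real (rep_count m A n))\<^sup>2) = (\<Sum>n\<in>?I. (?d n)\<^sup>2)"
    using sum_rep_count_squared_eq_sum_diff_count_squared[OF fin assms(2)]
    by (simp flip: of_nat_sum of_nat_power)
  moreover have "(k\<^sup>2 - k)\<^sup>2 \<le> real m * (\<Sum>n\<in>?J. (?d n)\<^sup>2)"
  proof -
    have "(k\<^sup>2 - k)\<^sup>2 \<le> real (card ?J) * (\<Sum>n\<in>?J. (?d n)\<^sup>2)"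
      using sum_squared_le_sum_of_squares[of ?d ?J] by (simp only: J mult.commute)
    also have "\<dots> \<le> real m * (\<Sum>n\<in>?J. (?d n)\<^sup>2)"
      using 0 by (intro mult_right_mono sum_nonneg) auto
    finally show ?thesis .
  qed
  ultimately show ?thesis by (simp add: distrib_left)
qed

section \<open>Parity of the representation counts and the upper bound for the energy\<close>

lemma odd_rep_count_imp_double:
  assumes "finite A" "odd (rep_count m A n)"
  shows "\<exists>a\<in>A. [a + a = n] (mod int m)"
proof (rule ccontr)
  assume none: "\<not> ?thesis"
  let ?L = "{(a, a'). a \<in> A \<and> a' \<in> A \<and> [a + a' = n] (mod int m) \<and> a < a'}"
  let ?G = "{(a, a'). a \<in> A \<and> a' \<in> A \<and> [a + a' = n] (mod int m) \<and> a' < a}"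
  \<comment> \<open>Without a diagonal solution, the swap pairs off the solutions with
    \<open>a < a'\<close> and those with \<open>a' < a\<close>.\<close>
  have "{(a, a'). a \<in> A \<and> a' \<in> A \<and> [a + a' = n] (mod int m)} = ?L \<union> ?G"
    using none by (auto simp: not_less_iff_gr_or_eq)
  moreover have "finite ?L" "finite ?G"
    by (rule finite_subset[of _ "A \<times> A"]; use assms(1) in auto)+
  moreover have "?L \<inter> ?G = {}" by auto
  moreover have "card ?G = card ?L"
  proof -
    have "?G = prod.swap ` ?L"
      by (auto simp: image_iff add.commute)
    then show ?thesis by (simp add: card_image)
  qed
  ultimately have "rep_count m A n = 2 * card ?L"
    by (simp add: rep_count_def card_Un_disjoint)
  with assms(2) show False by simp
qed

text \<open>The residues with odd count lie in the image of \<open>A\<close> under doubling.\<close>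

lemma card_odd_rep_count_le:
  assumes "finite A"
  shows "card {n\<in>{0..<int m}. odd (rep_count m A n)} \<le> card A"
proof (rule surj_card_le[OF assms])
  show "{n\<in>{0..<int m}. odd (rep_count m A n)} \<subseteq> (\<lambda>a. (a + a) mod int m) ` A"
  proof
    fix n assume n: "n \<in> {n\<in>{0..<int m}. odd (rep_count m A n)}"
    then obtain a where "a \<in> A" "[a + a = n] (mod int m)"
      using odd_rep_count_imp_double[OF assms] by blast
    then show "n \<in> (\<lambda>a. (a + a) mod int m) ` A"
      using n by (auto simp: cong_def image_iff intro!: bexI[of _ a])
  qed
qed

lemma energy_upper_bound:
  assumes "rep_bounded m 6 A" "m > 0"
  defines "k \<equiv> real (card A)"
  shows "(\<Sum>n\<in>{0..<int m}. (real (rep_count m A n))\<^sup>2) \<le> 8 * k\<^sup>2 - 12 * real m + 5 * k"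
proof -
  let ?I = "{0..<int m}" and ?r = "\<lambda>n. real (rep_count m A n)"
  have fin: "finite A"
    using assms(1) finite_subset unfolding rep_bounded_def by blast
  have sum: "(\<Sum>n\<in>?I. ?r n) = k\<^sup>2"
    using sum_rep_count[OF fin assms(2)] by (simp add: k_def flip: of_nat_sum)
  \<comment> \<open>At 2, 4, 6 the product is 0, -4, 0; at 1, 3, 5 it is 5, -3, -3. So 5 is the
    worst case, and it is charged only to odd counts.\<close>
  have "(?r n - 2) * (?r n - 6) \<le> (if odd (rep_count m A n) then 5 else 0)" if "n \<in> ?I" for n
  proof -
    have "rep_count m A n \<in> {1..6}" using assms(1) that by (simp add: rep_bounded_def)
    also have "{1..6} = {1, 2, 3, 4, 5, 6::nat}" by auto
    finally show ?thesis by auto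
  qed
  then have "(\<Sum>n\<in>?I. (?r n - 2) * (?r n - 6)) \<le>
      (\<Sum>n\<in>?I. if odd (rep_count m A n) then 5 else 0)"
    by (rule sum_mono)
  also have "\<dots> = 5 * real (card {n\<in>?I. odd (rep_count m A n)})"
    by (simp add: sum.inter_filter[symmetric])
  also have "\<dots> \<le> 5 * k"
    using card_odd_rep_count_le[OF fin, of m] by (simp add: k_def)
  finally have "(\<Sum>n\<in>?I. (?r n - 2) * (?r n - 6)) \<le> 5 * k" .
  moreover have "(\<Sum>n\<in>?I. (?r n - 2) * (?r n - 6)) = (\<Sum>n\<in>?I. (?r n)\<^sup>2) - 8 * k\<^sup>2 + 12 * real m"
  proof -
    have "(\<Sum>n\<in>?I. (?r n - 2) * (?r n - 6)) = (\<Sum>n\<in>?I. (?r n)\<^sup>2 - 8 * ?r n + 12)"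
      by (intro sum.cong refl) (simp add: algebra_simps power2_eq_square)
    then show ?thesis
      by (simp add: sum.distrib sum_subtractf sum sum_distrib_left[symmetric])
  qed
  ultimately show ?thesis by simp
qed

section \<open>The quartic inequality and the resulting bounds on the cardinality\<close>

lemma rep_bounded_6_card_ineq:
  assumes "rep_bounded m 6 A" "m > 0"
  defines "k \<equiv> real (card A)" and "s \<equiv> sqrt (real m)"
  shows "(k\<^sup>2 - 3 * s\<^sup>2) * (k\<^sup>2 - 4 * s\<^sup>2) \<le> 43 * s ^ 3"
proof -
  have A: "A \<subseteq> {0..<int m}" using assms(1) by (simp add: rep_bounded_def)
  then have fin: "finite A" using finite_subset by blast
  have s: "s \<ge> 0" "real m = s\<^sup>2" and k: "k \<ge> 0" by (simp_all add: s_def k_def)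
  \<comment> \<open>The trivial bound \<open>k\<^sup>2 \<le> 6 m\<close> suffices to control the
    lower-order cubic terms.\<close>
  have "(card A)\<^sup>2 \<le> (\<Sum>n\<in>{0..<int m}. 6)"
    unfolding sum_rep_count[OF fin assms(2), symmetric]
    by (rule sum_mono) (use assms(1) in \<open>simp add: rep_bounded_def\<close>)
  then have "(card A)\<^sup>2 \<le> 6 * m" by simp
  then have "real ((card A)\<^sup>2) \<le> real (6 * m)" by (rule of_nat_mono)
  then have k2: "k\<^sup>2 \<le> 6 * s\<^sup>2" by (simp add: k_def s_def)
  \<comment> \<open>5/2 is a rational upper bound for \<open>sqrt 6\<close>.\<close>
  have "k \<le> 5/2 * s"
  proof (rule power2_le_imp_le)
    have "(5/2 * s)\<^sup>2 = 25/4 * s\<^sup>2" by (simp add: power2_eq_square)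
    with k2 zero_le_power2[of s] show "k\<^sup>2 \<le> (5/2 * s)\<^sup>2" by linarith
  qed (use s in simp)
  have "s\<^sup>2 * k\<^sup>2 + (k\<^sup>2 - k)\<^sup>2 \<le> s\<^sup>2 * (8 * k\<^sup>2 - 12 * s\<^sup>2 + 5 * k)"
    using energy_lower_bound[OF A assms(2)]
      mult_left_mono[OF energy_upper_bound[OF assms(1,2)], of "real m"]
    unfolding k_def[symmetric] s(2) by simp
  \<comment> \<open>The quartic terms form
    \<open>k\<^sup>4 - 7 k\<^sup>2 s\<^sup>2 + 12 s\<^sup>4\<close>, which factors; everything else
    moves to the right.\<close>
  then have "(k\<^sup>2 - 3 * s\<^sup>2) * (k\<^sup>2 - 4 * s\<^sup>2) \<le> k * (2 * k\<^sup>2 + 5 * s\<^sup>2) - k\<^sup>2"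
    by (simp add: algebra_simps power2_eq_square)
  \<comment> \<open>17 = 2 * 6 + 5; below, 5/2 * 17 = 42.5 is rounded up to 43.\<close>
  also have "\<dots> \<le> k * (17 * s\<^sup>2)"
    using k2 k zero_le_power2[of k] mult_left_mono[of "2 * k\<^sup>2 + 5 * s\<^sup>2" "17 * s\<^sup>2" k] by linarith
  also have "\<dots> \<le> (5/2 * s) * (17 * s\<^sup>2)"
    using \<open>k \<le> 5/2 * s\<close> by (rule mult_right_mono) simp
  also have "\<dots> \<le> 43 * s ^ 3"
    using s by (simp add: power2_eq_square power3_eq_cube)
  finally show ?thesis .
qed

text \<open>Outside the claimed range both factors have the same sign, one of absolute value at
  least \<open>e * s\<^sup>2\<close> and the other at least \<open>s\<^sup>2\<close>. Their product
  is then at least \<open>e * s\<^sup>4\<close>, which exceeds \<open>43 * s\<^sup>3\<close> by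
  \<open>large\<close>.\<close>

lemma quartic_bounds:
  fixes k s e :: real
  assumes ineq: "(k\<^sup>2 - 3 * s\<^sup>2) * (k\<^sup>2 - 4 * s\<^sup>2) \<le> 43 * s ^ 3"
    and "k \<ge> 0" "s > 0" "e > 0" and large: "e * s > 43"
  shows "(sqrt 3 - e) * s \<le> k \<and> k \<le> (2 + e) * s"
proof -
  have contra: False if "(e * s\<^sup>2) * s\<^sup>2 \<le> (k\<^sup>2 - 3 * s\<^sup>2) * (k\<^sup>2 - 4 * s\<^sup>2)"
  proof -
    have "(e * s) * s ^ 3 \<le> 43 * s ^ 3"
      using that ineq by (simp add: power2_eq_square power3_eq_cube mult_ac)
    with \<open>s > 0\<close> large show False by simp
  qed
  have "k \<le> (2 + e) * s"
  proof (rule ccontr)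
    assume "\<not> k \<le> (2 + e) * s"
    then have "((2 + e) * s)\<^sup>2 \<le> k\<^sup>2"
      using assms by (intro power_mono) auto
    moreover have "(2 + e)\<^sup>2 * s\<^sup>2 \<ge> (4 + e) * s\<^sup>2"
      by (rule mult_right_mono) (use \<open>e > 0\<close> in \<open>auto simp: power2_eq_square algebra_simps\<close>)
    ultimately have *: "k\<^sup>2 \<ge> 4 * s\<^sup>2 + e * s\<^sup>2"
      by (simp add: power_mult_distrib distrib_right[of 4 e])
    moreover have "e * s\<^sup>2 \<ge> 0" using \<open>e > 0\<close> by simp
    ultimately have "s\<^sup>2 * (e * s\<^sup>2) \<le> (k\<^sup>2 - 3 * s\<^sup>2) * (k\<^sup>2 - 4 * s\<^sup>2)"
      using zero_le_power2[of s] by (intro mult_mono) linarith+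
    then show False using contra by (simp add: mult.commute)
  qed
  moreover have "(sqrt 3 - e) * s \<le> k"
  proof (rule ccontr)
    assume less: "\<not> (sqrt 3 - e) * s \<le> k"
    with \<open>k \<ge> 0\<close> have "(sqrt 3 - e) * s > 0" by linarith
    \<comment> \<open>For \<open>e \<ge> sqrt 3\<close> the lower bound is trivial, so its failure
      forces \<open>e < sqrt 3\<close>; this gives the sign of \<open>(sqrt 3 - e) * e\<close>
      below.\<close>
    with \<open>s > 0\<close> have e: "e < sqrt 3" by (simp add: zero_less_mult_iff)
    have "k\<^sup>2 \<le> ((sqrt 3 - e) * s)\<^sup>2"
      using less \<open>k \<ge> 0\<close> by (intro power_mono) auto
    moreover have "(sqrt 3 - e)\<^sup>2 * s\<^sup>2 \<le> (3 - e) * s\<^sup>2"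
    proof (rule mult_right_mono)
      have "(sqrt 3 - e)\<^sup>2 = 3 - sqrt 3 * e - (sqrt 3 - e) * e"
        by (simp add: power2_eq_square algebra_simps)
      moreover have "sqrt 3 * e \<ge> 1 * e"
        using \<open>e > 0\<close> by (intro mult_right_mono) auto
      moreover have "(sqrt 3 - e) * e \<ge> 0" using e \<open>e > 0\<close> by simp
      ultimately show "(sqrt 3 - e)\<^sup>2 \<le> 3 - e" by linarith
    qed simp
    ultimately have "k\<^sup>2 \<le> 3 * s\<^sup>2 - e * s\<^sup>2"
      by (simp add: power_mult_distrib left_diff_distrib[of 3 e])
    moreover have "e * s\<^sup>2 \<ge> 0" using \<open>e > 0\<close> by simp
    \<comment> \<open>Both factors are negative here, so each is negated before the estimates are
      multiplied.\<close>
    ultimately have "(e * s\<^sup>2) * s\<^sup>2 \<le> (3 * s\<^sup>2 - k\<^sup>2) * (4 * s\<^sup>2 - k\<^sup>2)"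
      using zero_le_power2[of s] by (intro mult_mono) linarith+
    then show False using contra by (simp add: algebra_simps)
  qed
  ultimately show ?thesis by simp
qed

theorem corollary2:
  fixes \<epsilon> :: real
  assumes "\<epsilon> > 0"
  shows "\<exists>m0::nat. \<forall>m\<ge>m0. \<forall>A\<in>ruzsa_sets m. ruzsa_number m = 6 \<longrightarrow>
           (sqrt 3 - \<epsilon>) * sqrt (real m) \<le> real (card A) \<and>
           real (card A) \<le> (2 + \<epsilon>) * sqrt (real m)"
proof -
  \<comment> \<open>The threshold makes \<open>\<epsilon> * sqrt m > 43\<close>, where 43 is the
    constant of the quartic inequality.\<close>
  obtain m0 :: nat where m0: "(43 / \<epsilon>)\<^sup>2 < real m0"
    using reals_Archimedean2 by blast
  show ?thesis
  proof (intro exI[of _ m0] allI ballI impI)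
    fix m A
    assume "m \<ge> m0" and A: "A \<in> ruzsa_sets m" "ruzsa_number m = 6"
    then have "(43 / \<epsilon>)\<^sup>2 < real m" using m0 by linarith
    then have "43 / \<epsilon> < sqrt (real m)" by (rule real_less_rsqrt)
    then have large: "\<epsilon> * sqrt (real m) > 43"
      using assms by (simp add: field_simps)
    then have "m > 0" by (cases m) auto
    moreover have "rep_bounded m 6 A" using A by (simp add: ruzsa_sets_def)
    ultimately show "(sqrt 3 - \<epsilon>) * sqrt (real m) \<le> real (card A) \<and>
        real (card A) \<le> (2 + \<epsilon>) * sqrt (real m)"
      using assms large by (intro quartic_bounds rep_bounded_6_card_ineq) simp_all
  qed
qed

end
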